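(* Let $(N,v,\Gamma)$ be an organisational situation with $\Gamma=(N,A)$ (so that the game $v$ is superadditive), let $(i_0,j_0)\in A$, and let $\Gamma^{-i_0j_0}=(N,A\setminus\{(i_0,j_0)\})$. Then: (i) (Direct competition reduction effect) for every $i_k\in DC(i_0,j_0)$ such that $i_k\notin P^\Gamma(j)$ for all $j\in\widehat P^\Gamma(j_0)$, one has $AF_{i_k}(N,v,\Gamma)\le AF_{i_k}(N,v,\Gamma^{-i_0j_0})$. (ii) (Direct subordinate reduction effect) if $i_0\notin IC(i_0,j_0)$, then $AF_{i_0}(N,v,\Gamma)\ge AF_{i_0}(N,v,\Gamma^{-i_0j_0})$.
   Context: Let $N=\{1,\dots,n\}$, $n\ge 2$. A TU game on $N$ is a function $v:2^N\to\mathbb{R}$ with $v(\emptyset)=0$; it is superadditive if $v(S\cup Q)\ge v(S)+v(Q)$ for all disjoint $S,Q\subseteq N$. A digraph $\Gamma=(N,A)$ on $N$ has arc set $A\subseteq\{(i,j)\mid i,j\in N,\ i\ne j\}$. A circuit is a directed cycle (of length at least 2). Connectedness and connected components of a digraph are understood in the weak sense (arc directions ignored). If there is a directed path from $i$ to $j$ (with at least one arc), $j$ is a successor of $i$ and $i$ is a predecessor of $j$; if $(i,j)\in A$, they are immediate successor/predecessor. $S^\Gamma(i)$ and $\widehat S^\Gamma(i)$ denote the sets of successors and immediate successors of $i$, $\bar S^\Gamma(i)=S^\Gamma(i)\cup\{i\}$, and $P^\Gamma(i)$ and $\widehat P^\Gamma(i)$ denote the sets of predecessors and immediate predecessors of $i$.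 An arborescence is a weakly connected circuit-free digraph having a unique root (a node from which every other node is reachable by a directed path) such that the directed path from the root to any other node is unique (a single node is an arborescence). A forest is a digraph whose connected components are arborescences. A spanning forest of $\Gamma=(N,A)$ is a forest $(N,A')$ with $A'\subseteq A$; it is maximal if adding to it any other arc of $A$ does not give a forest. $\mathcal{F}^\Gamma$ denotes the set of maximal spanning forests of $\Gamma$. An organisational situation $(N,v,\Gamma)$ consists of a superadditive game $v$ on $N$ and a circuit-free digraph $\Gamma$ on $N$. For $F\in\mathcal{F}^\Gamma$ and $i\in N$ set $$m_i^{(v,\Gamma)}(F)=v(\bar S^F(i))-\sum_{j\in\widehat S^F(i)}v(\bar S^F(j)).$$ The average forest measure is $$AF_i(N,v,\Gamma)=\frac{1}{|\mathcal{F}^\Gamma|}\sum_{F\in\mathcal{F}^\Gamma}m_i^{(v,\Gamma)}(F),\qquad i\in N.$$ For an arc $(i_0,j_0)\in A$, the set of direct competitors of $i_0$ over $j_0$ is $DC(i_0,j_0)=\widehat P^\Gamma(j_0)\setminus\{i_0\}$, and the set of indirect competitors of $i_0$ over $j_0$ is $IC(i_0,j_0)=\bigcup_{k\in DC(i_0,j_0)}P^\Gamma(k)$. *)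

theory Defs
  imports Complex_Main "Graph_Theory.Digraph_Component"
begin

text \<open>
  A game on \<open>N\<close> is a function on all sets, of which only the values on
  subsets of \<open>N\<close> are relevant.
\<close>

definition tu_game :: "'a set \<Rightarrow> ('a set \<Rightarrow> real) \<Rightarrow> bool" where
  "tu_game N v \<longleftrightarrow> finite N \<and> v {} = 0"

definition superadditive :: "'a set \<Rightarrow> ('a set \<Rightarrow> real) \<Rightarrow> bool" where
  "superadditive N v \<longleftrightarrow>
     (\<forall>S Q. S \<subseteq> N \<longrightarrow> Q \<subseteq> N \<longrightarrow> S \<inter> Q = {} \<longrightarrow> v (S \<union> Q) \<ge> v S + v Q)"

definition succs :: "('a, 'b) pre_digraph \<Rightarrow> 'a \<Rightarrow> 'a set" where
  "succs G i = {j. i \<rightarrow>\<^sup>+\<^bsub>G\<^esub> j}"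

definition imm_succs :: "('a, 'b) pre_digraph \<Rightarrow> 'a \<Rightarrow> 'a set" where
  "imm_succs G i = {j. i \<rightarrow>\<^bsub>G\<^esub> j}"

definition succs_refl :: "('a, 'b) pre_digraph \<Rightarrow> 'a \<Rightarrow> 'a set" where
  "succs_refl G i = succs G i \<union> {i}"

definition preds :: "('a, 'b) pre_digraph \<Rightarrow> 'a \<Rightarrow> 'a set" where
  "preds G j = {i. i \<rightarrow>\<^sup>+\<^bsub>G\<^esub> j}"

definition imm_preds :: "('a, 'b) pre_digraph \<Rightarrow> 'a \<Rightarrow> 'a set" where
  "imm_preds G j = {i. i \<rightarrow>\<^bsub>G\<^esub> j}"

definition circuit_free :: "('a, 'b) pre_digraph \<Rightarrow> bool" where
  "circuit_free G \<longleftrightarrow> \<not> (\<exists>p. pre_digraph.cycle G p)"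

definition is_root :: "('a, 'b) pre_digraph \<Rightarrow> 'a \<Rightarrow> bool" where
  "is_root G r \<longleftrightarrow> r \<in> verts G \<and> (\<forall>u \<in> verts G - {r}. r \<rightarrow>\<^sup>*\<^bsub>G\<^esub> u)"

text \<open>
  The library's \<open>connected\<close> is weak connectedness: it refers to the underlying
  symmetric graph.
\<close>

definition arborescence :: "('a, 'b) pre_digraph \<Rightarrow> bool" where
  "arborescence G \<longleftrightarrow>
     wf_digraph G \<and> Digraph_Component.connected G \<and> circuit_free G \<and>
     (\<exists>!r. is_root G r) \<and>
     (\<forall>r. is_root G r \<longrightarrow> (\<forall>u \<in> verts G - {r}. \<exists>!p. pre_digraph.apath G r p u))"

text \<open>
  The library's \<open>forest\<close> only means absence of directed cycles, so a separate
  notion is needed: every weakly connected component is an arborescence.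
\<close>

definition directed_forest :: "('a, 'b) pre_digraph \<Rightarrow> bool" where
  "directed_forest G \<longleftrightarrow>
     wf_digraph G \<and>
     (\<forall>C. pre_digraph.max_subgraph G Digraph_Component.connected C \<longrightarrow> arborescence C)"

definition spanning_forest :: "'a pair_pre_digraph \<Rightarrow> 'a pair_pre_digraph \<Rightarrow> bool" where
  "spanning_forest F G \<longleftrightarrow>
     spanning (with_proj F) (with_proj G) \<and> directed_forest (with_proj F)"

definition max_spanning_forests :: "'a pair_pre_digraph \<Rightarrow> 'a pair_pre_digraph set" where
  "max_spanning_forests G =
     {F. spanning_forest F G \<and>
         (\<forall>e \<in> parcs G - parcs F.
            \<not> directed_forest (with_proj (F\<lparr>parcs := insert e (parcs F)\<rparr>)))}"

definition delete_arc :: "'a pair_pre_digraph \<Rightarrow> 'a \<times> 'a \<Rightarrow> 'a pair_pre_digraph" where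
  "delete_arc G e = G\<lparr>parcs := parcs G - {e}\<rparr>"

definition organisational_situation ::
    "'a set \<Rightarrow> ('a set \<Rightarrow> real) \<Rightarrow> 'a pair_pre_digraph \<Rightarrow> bool" where
  "organisational_situation N v G \<longleftrightarrow>
     tu_game N v \<and> superadditive N v \<and>
     pair_digraph G \<and> pverts G = N \<and> circuit_free (with_proj G)"

definition marginal :: "('a set \<Rightarrow> real) \<Rightarrow> 'a pair_pre_digraph \<Rightarrow> 'a \<Rightarrow> real" where
  "marginal v F i =
     v (succs_refl (with_proj F) i)
     - (\<Sum>j \<in> imm_succs (with_proj F) i. v (succs_refl (with_proj F) j))"

definition AF :: "('a set \<Rightarrow> real) \<Rightarrow> 'a pair_pre_digraph \<Rightarrow> 'a \<Rightarrow> real" where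
  "AF v G i =
     (1 / real (card (max_spanning_forests G)))
     * (\<Sum>F \<in> max_spanning_forests G. marginal v F i)"

definition DC :: "'a pair_pre_digraph \<Rightarrow> 'a \<Rightarrow> 'a \<Rightarrow> 'a set" where
  "DC G i\<^sub>0 j\<^sub>0 = imm_preds (with_proj G) j\<^sub>0 - {i\<^sub>0}"

definition IC :: "'a pair_pre_digraph \<Rightarrow> 'a \<Rightarrow> 'a \<Rightarrow> 'a set" where
  "IC G i\<^sub>0 j\<^sub>0 = (\<Union>k \<in> DC G i\<^sub>0 j\<^sub>0. preds (with_proj G) k)"

end

theory Submission
  imports Defs
begin

text \<open>
  In a circuit-free digraph a subgraph is a directed forest iff every node has at most one
  immediate predecessor, so a maximal spanning forest is a free choice of one immediate
  predecessor for every node that has any. Splitting off the choice made at \<open>j\<close>, the forests of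
  \<open>\<Gamma>\<close> are the pairs of an immediate predecessor \<open>k\<close> of \<open>j\<close> and a maximal spanning forest \<open>F\<close>
  of \<open>\<Gamma>\<close> without the arcs into \<open>j\<close>; deleting \<open>(i, j)\<close> changes only the range of \<open>k\<close>. If \<open>x\<close>
  is no predecessor of an immediate predecessor of \<open>j\<close>, then attaching \<open>j\<close> to \<open>k \<noteq> x\<close> leaves the
  marginal contribution of \<open>x\<close> in \<open>F\<close> unchanged, while attaching it to \<open>x\<close> raises it by
  superadditivity. With \<open>s \<le> t\<close> the sums over \<open>F\<close> of these two contributions, \<open>M\<close> the number
  of forests \<open>F\<close> and \<open>d\<close> the number of immediate predecessors of \<open>j\<close>, the value of \<open>x\<close> is
  \<open>(s + (t - s) / d) / M\<close> if \<open>x\<close> is one of them and \<open>s / M\<close> otherwise. Deleting \<open>(i, j)\<close> lowers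
  \<open>d\<close> by one, which favours \<open>x \<noteq> i\<close>, and moves \<open>x = i\<close> from the first case to the second.
\<close>

section \<open>Circuits and maximal subgraphs\<close>

lemma circuit_free_iff_acyclic:
  assumes "pair_wf_digraph G"
  shows "circuit_free (with_proj G) \<longleftrightarrow> acyclic (parcs G)"
proof -
  interpret pair_wf_digraph G by fact
  have "\<exists>p. cycle p" if u: "(u, u) \<in> (parcs G)\<^sup>+" for u
  proof -
    obtain p where "awalk u p u" "p \<noteq> []" using reachable1_awalk[THEN iffD1, OF u] by blast
    then have "closed_w p" by (auto simp: closed_w_def)
    then show ?thesis by (rule closed_w_imp_cycle)
  qed
  moreover have "\<exists>u. (u, u) \<in> (parcs G)\<^sup>+" if "cycle p" for p
    using that unfolding reachable1_awalk cycle_def by auto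
  ultimately show ?thesis
    unfolding circuit_free_def acyclic_def by blast
qed

text \<open>Among the subgraphs containing \<open>H0\<close> and satisfying \<open>P\<close>, whose
  size is bounded since the digraph is finite, one with the most vertices and arcs is maximal. It
  serves to enlarge a connected subgraph to a weak component.\<close>

lemma (in fin_digraph) ex_max_subgraph:
  assumes "subgraph H0 G" "P H0"
  obtains H where "max_subgraph P H" "subgraph H0 H"
proof -
  let ?Q = "\<lambda>H. subgraph H G \<and> P H \<and> subgraph H0 H"
  let ?f = "\<lambda>H. card (verts H) + card (arcs H)"
  have "?Q H0" using assms by (auto intro: wf_digraph.subgraph_refl)
  moreover have "\<forall>H. ?Q H \<longrightarrow> ?f H < Suc (card (verts G) + card (arcs G))"
    by (auto simp: less_Suc_eq_le subgraph_def intro!: add_mono card_mono finite_verts finite_arcs)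
  ultimately obtain H where H: "?Q H" and max: "\<And>H'. ?Q H' \<Longrightarrow> ?f H' \<le> ?f H"
    using ex_has_greatest_nat[of ?Q H0 ?f] by blast
  have "H' = H" if "subgraph H H'" "subgraph H' G" "P H'" for H'
  proof -
    have sub: "verts H \<subseteq> verts H'" "arcs H \<subseteq> arcs H'" using that by auto
    have "fin_digraph H'" using that(2) by (rule fin_digraph_subgraph)
    then have fin: "finite (verts H')" "finite (arcs H')"
      by (auto simp: fin_digraph.finite_verts fin_digraph.finite_arcs)
    have "?f H' \<le> ?f H" using that H max subgraph_trans by blast
    moreover have "card (verts H) \<le> card (verts H')" "card (arcs H) \<le> card (arcs H')"
      using sub fin by (auto intro: card_mono)
    ultimately have "card (verts H) = card (verts H')" "card (arcs H) = card (arcs H')" by auto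
    then have "verts H = verts H'" "arcs H = arcs H'"
      using sub fin card_subset_eq by blast+
    with that(1) show ?thesis by (auto simp: subgraph_def compatible_def intro: pre_digraph.equality)
  qed
  with H that show ?thesis unfolding max_subgraph_def by blast
qed

section \<open>Directed forests as acyclic digraphs of in-degree at most one\<close>

lemma single_valued_converseD:
  "single_valued (r\<inverse>) \<Longrightarrow> (x, z) \<in> r \<Longrightarrow> (y, z) \<in> r \<Longrightarrow> x = y"
  by (auto dest: single_valuedD)

text \<open>Well-foundedness of the arcs yields a source \<open>r\<close>. Weak connectedness joins
  \<open>r\<close> to every node by an undirected walk, and in-degree at most one makes the end of
  such a walk reachable along directed arcs.\<close>

lemma arborescenceI:
  assumes fin: "pair_fin_digraph H" and con: "connected (with_proj H)"
    and acyc: "acyclic (parcs H)" and indeg: "single_valued ((parcs H)\<inverse>)"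
  shows "arborescence (with_proj H)"
proof -
  interpret pair_fin_digraph H by fact
  note sv = single_valued_converseD[OF indeg]
  have wf: "wf (parcs H)" using acyc pair_finite_arcs by (rule finite_acyclic_wf[rotated])
  have con': "pverts H \<noteq> {}"
    "\<And>u v. u \<in> pverts H \<Longrightarrow> v \<in> pverts H \<Longrightarrow> (u, v) \<in> rtrancl_on (pverts H) ((parcs H)\<^sup>s)"
    using con by (auto simp: connected_conv)
  obtain r where r: "r \<in> pverts H" and source: "\<And>u. (u, r) \<notin> parcs H"
    using wfE_min'[OF wf con'(1)] in_arcsD1 by metis
  have reach: "(r, u) \<in> (parcs H)\<^sup>*" if "u \<in> pverts H" for u
    using con'(2)[OF r that]
  proof (induct rule: rtrancl_on_induct)
    case (step y z)
    then consider "(y, z) \<in> parcs H" | "(z, y) \<in> parcs H" by (auto simp: symcl_def)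
    then show ?case
    proof cases
      case 2
      \<comment> \<open>The arc is crossed against its direction. As \<open>y\<close> is not the
        source, the directed walk from \<open>r\<close> to \<open>y\<close> ends with an arc into
        \<open>y\<close>, which must be \<open>(z, y)\<close>; dropping it leads to
        \<open>z\<close>.\<close>
      then have "y \<noteq> r" using source by auto
      then obtain w where "(r, w) \<in> (parcs H)\<^sup>*" "(w, y) \<in> parcs H"
        using step by (auto elim: rtranclE)
      with 2 sv show ?thesis by metis
    qed (use step in auto)
  qed auto
  have root: "is_root (with_proj H) r"
    using r reach by (auto simp: is_root_def reachable_conv')
  have root_eq: "s = r" if "is_root (with_proj H) s" for s
  proof (rule ccontr)
    assume "s \<noteq> r"
    then have "(s, r) \<in> (parcs H)\<^sup>+" using that r by (auto simp: is_root_def)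
    then show False using source by (auto elim: tranclE)
  qed
  \<comment> \<open>Walks are compared from their last arcs: equal heads force equal arcs, and
    neither walk outlasts the other since no arc enters \<open>r\<close>.\<close>
  have awalk_unique: "p = q" if "awalk r p u" "awalk r q u" for p q u
    using that
  proof (induct p arbitrary: q u rule: rev_induct)
    case Nil
    then have "u = r" by (auto simp: awalk_Nil_iff)
    show ?case
    proof (cases q rule: rev_cases)
      case (snoc q' e)
      with Nil \<open>u = r\<close> have "e \<in> parcs H" "snd e = r" by (auto simp: awalk_Cons_iff awalk_Nil_iff)
      then show ?thesis using source by (metis prod.collapse)
    qed simp
  next
    case (snoc e p)
    then have e: "awalk r p (fst e)" "e \<in> parcs H" "snd e = u"
      by (auto simp: awalk_simps)
    show ?case
    proof (cases q rule: rev_cases)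
      case Nil
      then show ?thesis using snoc.prems e source by (metis awalk_Nil_iff prod.collapse)
    next
      case (snoc q' e')
      then have e': "awalk r q' (fst e')" "e' \<in> parcs H" "snd e' = u"
        using \<open>awalk r q u\<close> by (auto simp: awalk_simps)
      then have "e' = e" using e sv by (metis prod.collapse)
      then show ?thesis using snoc snoc.hyps e e' by auto
    qed
  qed
  have "\<exists>!p. apath r p u" if "u \<in> pverts H" for u
  proof -
    have "r \<rightarrow>\<^sup>*\<^bsub>with_proj H\<^esub> u" using reach[OF that] r by (simp add: reachable_conv')
    then show ?thesis using awalk_unique unfolding reachable_apath apath_def by metis
  qed
  then show ?thesis
    using con root root_eq acyc circuit_free_iff_acyclic[OF fin[THEN pair_fin_digraph.axioms(1)]]
      wf_digraph_axioms
    unfolding arborescence_def with_proj_simps by (metis DiffD1)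
qed

lemma pair_fin_digraph_fewer_arcs:
  assumes "pair_fin_digraph G" "pverts H = pverts G" "parcs H \<subseteq> parcs G"
  shows "pair_fin_digraph H"
proof -
  interpret pair_fin_digraph G by fact
  show ?thesis
    using assms(2,3) in_arcsD1 in_arcsD2 pair_finite_verts finite_subset[OF assms(3) pair_finite_arcs]
    by unfold_locales auto
qed

text \<open>Weak components arise as general digraphs. Sharing the tail and head maps of
  \<open>with_proj F\<close> makes them pair digraphs again.\<close>

lemma with_proj_subgraphE:
  assumes "subgraph C (with_proj F)"
  obtains H where "C = with_proj H" "pair_wf_digraph H" "pverts H \<subseteq> pverts F" "parcs H \<subseteq> parcs F"
proof
  show C: "C = with_proj \<lparr>pverts = verts C, parcs = arcs C\<rparr>"
    using assms by (auto simp: subgraph_def compatible_def with_proj_def)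
  show "pair_wf_digraph \<lparr>pverts = verts C, parcs = arcs C\<rparr>"
    using assms C by (metis subgraph_def wf_digraph_wp_iff)
  show "pverts \<lparr>pverts = verts C, parcs = arcs C\<rparr> \<subseteq> pverts F"
    "parcs \<lparr>pverts = verts C, parcs = arcs C\<rparr> \<subseteq> parcs F"
    using assms by (auto simp: subgraph_def)
qed

lemma single_valued_converse_subset:
  "single_valued (s\<inverse>) \<Longrightarrow> r \<subseteq> s \<Longrightarrow> single_valued (r\<inverse>)"
  by (meson converse_mono single_valued_subset)

text \<open>All nodes are joined through \<open>j\<close>. With two tails in \<open>I\<close>, this
  places two arcs with a common head in one weak component.\<close>

lemma connected_arcs_into:
  assumes "I \<noteq> {}"
  shows "connected (with_proj \<lparr>pverts = insert j I, parcs = I \<times> {j}\<rparr>)" (is "connected ?H")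
proof -
  let ?R = "rtrancl_on (insert j I) ((I \<times> {j})\<^sup>s)"
  interpret wf_digraph ?H by unfold_locales auto
  have "(u, j) \<in> ?R \<and> (j, u) \<in> ?R" if "u \<in> insert j I" for u
    using that by (auto intro!: rtrancl_on_into_rtrancl_on[OF rtrancl_on_refl] simp: symcl_def)
  then show ?thesis
    unfolding connected_conv by (auto intro: rtrancl_on_trans)
qed

text \<open>A repeated vertex would cut out a closed walk of positive length. Uniqueness of paths in
  an arborescence thus extends to walks.\<close>

lemma (in pair_wf_digraph) acyclic_awalk_imp_apath:
  assumes acyc: "acyclic (parcs G)" and p: "awalk u p v"
  shows "apath u p v"
proof (rule ccontr)
  assume "\<not> apath u p v"
  with p have "\<not> distinct (pawalk_verts u p)" by (simp add: apath_def)
  then obtain w c where "awalk w c w" "0 < length c"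
    using awalk_not_distinct_decomp[OF p] by auto
  then have "(w, w) \<in> (parcs G)\<^sup>+" by (auto intro: reachable1_awalkI)
  with acyc show False by (simp add: acyclic_def)
qed

text \<open>Components inherit acyclicity and the bound on in-degrees. Conversely, two arcs with a
  common head lie in one component, whose root would then have two paths to that head, differing in
  the last arc.\<close>

lemma directed_forest_iff:
  assumes fin: "pair_fin_digraph F" and acyc: "acyclic (parcs F)"
  shows "directed_forest (with_proj F) \<longleftrightarrow> single_valued ((parcs F)\<inverse>)"
proof
  interpret pair_fin_digraph F by fact
  assume indeg: "single_valued ((parcs F)\<inverse>)"
  show "directed_forest (with_proj F)"
    unfolding directed_forest_def
  proof (intro conjI allI impI)
    fix C assume C: "max_subgraph connected C"
    then have sub: "subgraph C (with_proj F)" by (rule subgraphI_max_subgraph)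
    then obtain H where H: "C = with_proj H" "pair_wf_digraph H" "pverts H \<subseteq> pverts F" "parcs H \<subseteq> parcs F"
      by (rule with_proj_subgraphE)
    have "pair_fin_digraph H"
      using H(2) finite_subset[OF H(3) pair_finite_verts] finite_subset[OF H(4) pair_finite_arcs]
      by (simp add: pair_fin_digraph_def pair_fin_digraph_axioms_def)
    moreover have "connected (with_proj H)" using C H(1) max_subgraph_prop by blast
    ultimately show "arborescence C"
      unfolding H(1) using acyclic_subset[OF acyc H(4)] single_valued_converse_subset[OF indeg H(4)]
      by (rule arborescenceI)
  qed (rule wf_digraph_axioms)
next
  interpret pair_fin_digraph F by fact
  assume forest: "directed_forest (with_proj F)"
  have "i = i'" if arcs: "(i, j) \<in> parcs F" "(i', j) \<in> parcs F" for i i' j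
  proof (rule ccontr)
    assume "i \<noteq> i'"
    let ?H0 = "with_proj \<lparr>pverts = insert j {i, i'}, parcs = {i, i'} \<times> {j}\<rparr>"
    have "subgraph ?H0 (with_proj F)"
      by (rule subgraphI) (use arcs in_arcsD1 in_arcsD2 wf_digraph_axioms in
        \<open>auto simp: wf_digraph_wp_iff pair_wf_digraph_def\<close>)
    moreover have "connected ?H0" by (rule connected_arcs_into) simp
    ultimately obtain C where C: "max_subgraph connected C" "subgraph ?H0 C"
      using ex_max_subgraph by blast
    obtain H where H: "C = with_proj H" "pair_wf_digraph H" "pverts H \<subseteq> pverts F" "parcs H \<subseteq> parcs F"
      using C(1) by (metis subgraphI_max_subgraph with_proj_subgraphE)
    interpret H: pair_wf_digraph H by fact
    have arcsH: "(i, j) \<in> parcs H" "(i', j) \<in> parcs H"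
      using C(2) unfolding H(1) by auto
    have "arborescence C" using C(1) forest by (auto simp: directed_forest_def)
    then obtain r where r: "r \<in> pverts H" "\<And>u. u \<in> pverts H \<Longrightarrow> u \<noteq> r \<Longrightarrow> r \<rightarrow>\<^sup>*\<^bsub>with_proj H\<^esub> u"
      and unique: "\<And>u p q. u \<in> pverts H \<Longrightarrow> u \<noteq> r \<Longrightarrow> H.apath r p u \<Longrightarrow> H.apath r q u \<Longrightarrow> p = q"
      unfolding arborescence_def H(1) is_root_def with_proj_simps by (metis DiffI singletonD)
    have acycH: "acyclic (parcs H)" using acyc H(4) by (rule acyclic_subset)
    \<comment> \<open>A walk from the root to \<open>k\<close> is prolonged by
      \<open>(k, j)\<close>. It has positive length, so \<open>j = r\<close> would close a circuit;
      uniqueness of paths is available only for nodes other than \<open>r\<close>.\<close>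
    have path: "\<exists>p. H.apath r (p @ [(k, j)]) j \<and> j \<noteq> r" if k: "(k, j) \<in> parcs H" for k
    proof -
      have "r \<rightarrow>\<^sup>*\<^bsub>with_proj H\<^esub> k" using r k H.in_arcsD1 by (cases "k = r") auto
      then obtain p where p: "H.awalk r p k" unfolding H.reachable_awalk by blast
      then have "H.awalk r (p @ [(k, j)]) j"
        using k H.in_arcsD2 by (auto simp: H.awalk_simps)
      moreover from this have "(r, j) \<in> (parcs H)\<^sup>+"
        using H.reachable1_awalkI by blast
      then have "j \<noteq> r" using acycH by (auto simp: acyclic_def)
      ultimately show ?thesis using H.acyclic_awalk_imp_apath[OF acycH] by blast
    qed
    obtain p p' where "H.apath r (p @ [(i, j)]) j" "H.apath r (p' @ [(i', j)]) j" "j \<noteq> r"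
      using path arcsH by blast
    then have "p @ [(i, j)] = p' @ [(i', j)]" using unique arcsH H.in_arcsD2 by blast
    with \<open>i \<noteq> i'\<close> show False by simp
  qed
  then show "single_valued ((parcs F)\<inverse>)" by (auto intro!: single_valuedI)
qed

text \<open>An arc can be added to a spanning forest exactly when its head has no immediate
  predecessor there yet, so maximality says that every head of an arc of \<open>G\<close> is already
  served.\<close>

lemma max_spanning_forests_iff:
  assumes fin: "pair_fin_digraph G" and acyc: "acyclic (parcs G)"
  shows "F \<in> max_spanning_forests G \<longleftrightarrow>
    pverts F = pverts G \<and> parcs F \<subseteq> parcs G \<and> single_valued ((parcs F)\<inverse>) \<and>
    Range (parcs G) \<subseteq> Range (parcs F)"
proof -
  interpret pair_fin_digraph G by fact
  have forest_iff: "directed_forest (with_proj H) \<longleftrightarrow> single_valued ((parcs H)\<inverse>)"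
    if H: "pverts H = pverts G" "parcs H \<subseteq> parcs G" for H
  proof (rule directed_forest_iff)
    show "pair_fin_digraph H"
      using fin H by (rule pair_fin_digraph_fewer_arcs)
    show "acyclic (parcs H)" using acyc H(2) by (rule acyclic_subset)
  qed
  have spanning_iff: "spanning (with_proj F) (with_proj G) \<longleftrightarrow> pverts F = pverts G \<and> parcs F \<subseteq> parcs G"
    using wf_digraph_axioms in_arcsD1 in_arcsD2
    by (auto simp: spanning_def subgraph_def wf_digraph_wp_iff pair_wf_digraph_def)
  have "(\<forall>e \<in> parcs G - parcs F. \<not> directed_forest (with_proj (F\<lparr>parcs := insert e (parcs F)\<rparr>)))
      \<longleftrightarrow> Range (parcs G) \<subseteq> Range (parcs F)" (is "?max \<longleftrightarrow> _")
    if F: "pverts F = pverts G" "parcs F \<subseteq> parcs G" "single_valued ((parcs F)\<inverse>)"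
  proof -
    have "?max \<longleftrightarrow> (\<forall>e \<in> parcs G - parcs F. \<not> single_valued ((insert e (parcs F))\<inverse>))"
      using F by (intro ball_cong refl) (subst forest_iff; auto)
    \<comment> \<open>As \<open>e\<close> is not in \<open>F\<close>, an arc of \<open>F\<close>
      with the same head has a different tail.\<close>
    also have "\<dots> \<longleftrightarrow> (\<forall>e \<in> parcs G - parcs F. snd e \<in> Range (parcs F))"
      using F(3) by (intro ball_cong refl) (auto simp: single_valued_def; blast)
    also have "\<dots> \<longleftrightarrow> Range (parcs G) \<subseteq> Range (parcs F)"
      by (force simp: subset_iff Range_iff)
    finally show ?thesis .
  qed
  then show ?thesis
    unfolding max_spanning_forests_def spanning_forest_def mem_Collect_eq spanning_iff
    using forest_iff by blast
qed

section \<open>Marginal contributions when an arc is inserted\<close>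

lemma succs_refl_with_proj: "succs_refl (with_proj F) i = (parcs F)\<^sup>* `` {i}"
  by (auto simp: succs_refl_def succs_def rtrancl_eq_or_trancl)

lemma imm_succs_with_proj: "imm_succs (with_proj F) i = parcs F `` {i}"
  by (auto simp: imm_succs_def)

lemma preds_with_proj: "preds (with_proj G) j = {i. (i, j) \<in> (parcs G)\<^sup>+}"
  by (simp add: preds_def)

lemma imm_preds_with_proj: "imm_preds (with_proj G) j = {i. (i, j) \<in> parcs G}"
  by (simp add: imm_preds_def)

text \<open>Followed backwards, the arcs form a partial function, so the ancestors of
  \<open>z\<close> lie on a single chain.\<close>

lemma rtrancl_common_descendant:
  assumes "single_valued (r\<inverse>)" "(x, z) \<in> r\<^sup>*" "(y, z) \<in> r\<^sup>*"
  shows "(x, y) \<in> r\<^sup>* \<or> (y, x) \<in> r\<^sup>*"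
  using assms single_valued_confluent[of "r\<inverse>" z x y] by (auto simp: rtrancl_converse)

definition insert_arc :: "'a \<times> 'a \<Rightarrow> 'a pair_pre_digraph \<Rightarrow> 'a pair_pre_digraph" where
  "insert_arc e F = F\<lparr>parcs := insert e (parcs F)\<rparr>"

lemma insert_arc_simps [simp]:
  "pverts (insert_arc e F) = pverts F" "parcs (insert_arc e F) = insert e (parcs F)"
  by (simp_all add: insert_arc_def)

text \<open>A new arc out of \<open>k\<close> enlarges only the successor sets of nodes that reach
  \<open>k\<close>. Neither \<open>x\<close> nor its immediate successors do.\<close>

lemma marginal_insert_arc_unrelated:
  assumes "(x, k) \<notin> (parcs F)\<^sup>*"
  shows "marginal v (insert_arc (k, j) F) x = marginal v F x"
proof -
  have "(y, k) \<notin> (parcs F)\<^sup>*" if "y = x \<or> (x, y) \<in> parcs F" for y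
    using that assms by (auto intro: converse_rtrancl_into_rtrancl)
  moreover have "x \<noteq> k" using assms by auto
  ultimately show ?thesis
    by (auto simp: marginal_def succs_refl_with_proj imm_succs_with_proj rtrancl_insert Image_def
        intro!: sum.cong arg_cong[where f = v])
qed

text \<open>The tree below \<open>k\<close> absorbs the disjoint tree below \<open>j\<close>, and
  \<open>j\<close> becomes one more immediate successor. The gain is
  \<open>v (?S k \<union> ?S j) - v (?S k) - v (?S j)\<close>, nonnegative by
  superadditivity.\<close>

lemma marginal_insert_arc_tail:
  assumes fin: "pair_fin_digraph F" and sup: "superadditive (pverts F) v"
    and verts: "k \<in> pverts F" "j \<in> pverts F"
    and acyc: "acyclic (insert (k, j) (parcs F))"
    and indeg: "single_valued ((parcs F)\<inverse>)" and j: "j \<notin> Range (parcs F)"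
  shows "marginal v F k \<le> marginal v (insert_arc (k, j) F) k"
proof -
  interpret pair_fin_digraph F by fact
  let ?r = "parcs F" and ?F = "insert_arc (k, j) F"
  let ?S = "\<lambda>i. ?r\<^sup>* `` {i}"
  have acyc': "acyclic ?r" and jk: "(j, k) \<notin> ?r\<^sup>*"
    using acyc by auto
  \<comment> \<open>No arc enters \<open>j\<close>, so a walk from \<open>k\<close> to
    \<open>j\<close> would be empty; but \<open>k = j\<close> is excluded by
    \<open>jk\<close>.\<close>
  have kj: "(k, j) \<notin> ?r\<^sup>*" using jk j by (auto elim: rtranclE)
  have "(y, k) \<notin> ?r\<^sup>*" if "(k, y) \<in> ?r" for y
    using acyc' that unfolding acyclic_def by (meson rtrancl_into_trancl2)
  then have succs_same: "succs_refl (with_proj ?F) y = ?S y" if "(k, y) \<in> ?r \<or> y = j" for y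
    using that jk by (auto simp: succs_refl_with_proj rtrancl_insert)
  have "v (?S k) + v (?S j) \<le> v (?S k \<union> ?S j)"
  proof -
    have "?S i \<subseteq> pverts F" if "i \<in> pverts F" for i
      using that by (auto elim: rtranclE dest: in_arcsD2)
    moreover have "?S k \<inter> ?S j = {}"
      using rtrancl_common_descendant[OF indeg] kj jk by blast
    ultimately show ?thesis using sup verts by (simp add: superadditive_def)
  qed
  moreover have "succs_refl (with_proj ?F) k = ?S k \<union> ?S j"
    by (auto simp: succs_refl_with_proj rtrancl_insert)
  moreover have "(\<Sum>y \<in> imm_succs (with_proj ?F) k. v (succs_refl (with_proj ?F) y))
      = v (?S j) + (\<Sum>y \<in> ?r `` {k}. v (?S y))"
  proof -
    have "finite (?r `` {k})"
      using pair_finite_arcs by (rule finite_Image)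
    moreover have "j \<notin> ?r `` {k}" using j by auto
    moreover have "imm_succs (with_proj ?F) k = insert j (?r `` {k})"
      by (auto simp: imm_succs_with_proj)
    ultimately show ?thesis using succs_same by simp
  qed
  ultimately show ?thesis
    by (simp add: marginal_def succs_refl_with_proj[of F] imm_succs_with_proj[of F])
qed

section \<open>Splitting off the choice of an immediate predecessor of one node\<close>

definition remove_arcs_into :: "'a \<Rightarrow> 'a pair_pre_digraph \<Rightarrow> 'a pair_pre_digraph" where
  "remove_arcs_into j G = G\<lparr>parcs := {e \<in> parcs G. snd e \<noteq> j}\<rparr>"

lemma remove_arcs_into_simps [simp]:
  "pverts (remove_arcs_into j G) = pverts G"
  "parcs (remove_arcs_into j G) = {e \<in> parcs G. snd e \<noteq> j}"
  by (simp_all add: remove_arcs_into_def)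

lemma max_spanning_forests_remove_arcs_intoD:
  assumes fin: "pair_fin_digraph G" and acyc: "acyclic (parcs G)"
    and F: "F \<in> max_spanning_forests (remove_arcs_into j G)"
  shows "pverts F = pverts G" "parcs F \<subseteq> parcs G" "single_valued ((parcs F)\<inverse>)"
    "j \<notin> Range (parcs F)" "Range (parcs G) \<subseteq> insert j (Range (parcs F))"
proof -
  have "pair_fin_digraph (remove_arcs_into j G)"
    using fin by (rule pair_fin_digraph_fewer_arcs) auto
  moreover have "acyclic (parcs (remove_arcs_into j G))"
    using acyc by (rule acyclic_subset) auto
  ultimately have "pverts F = pverts (remove_arcs_into j G) \<and> parcs F \<subseteq> parcs (remove_arcs_into j G) \<and>
      single_valued ((parcs F)\<inverse>) \<and> Range (parcs (remove_arcs_into j G)) \<subseteq> Range (parcs F)"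
    using F max_spanning_forests_iff by blast
  then show "pverts F = pverts G" "parcs F \<subseteq> parcs G" "single_valued ((parcs F)\<inverse>)"
    "j \<notin> Range (parcs F)" "Range (parcs G) \<subseteq> insert j (Range (parcs F))"
    by force+
qed

text \<open>A maximal spanning forest contains exactly one arc into \<open>j\<close>, and exchanging
  or removing that arc does not affect the choices at other nodes.\<close>

lemma bij_betw_max_spanning_forests:
  assumes fin: "pair_fin_digraph G" and acyc: "acyclic (parcs G)" and j: "j \<in> Range (parcs G)"
  shows "bij_betw (\<lambda>(k, F). insert_arc (k, j) F)
    (imm_preds (with_proj G) j \<times> max_spanning_forests (remove_arcs_into j G))
    (max_spanning_forests G)"
proof -
  let ?P = "imm_preds (with_proj G) j" and ?M = "max_spanning_forests (remove_arcs_into j G)"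
  note MD = max_spanning_forests_remove_arcs_intoD[OF fin acyc]
  have fin': "pair_fin_digraph (remove_arcs_into j G)"
    using fin by (rule pair_fin_digraph_fewer_arcs) auto
  have acyc': "acyclic (parcs (remove_arcs_into j G))"
    using acyc by (rule acyclic_subset) auto
  have "k = k' \<and> F = F'"
    if F: "F \<in> ?M" and F': "F' \<in> ?M" and eq: "insert_arc (k, j) F = insert_arc (k', j) F'" for k F k' F'
  proof -
    have *: "pverts F = pverts F'" "insert (k, j) (parcs F) = insert (k', j) (parcs F')"
      using eq by (metis insert_arc_simps)+
    \<comment> \<open>The inserted arc is the only one into \<open>j\<close>, so it can be read off
      from the result.\<close>
    have **: "(i, j) \<notin> parcs F" "(i, j) \<notin> parcs F'" for i
      using MD(4)[OF F] MD(4)[OF F'] by auto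
    then have "k = k'" using *(2) by (metis insertE insertI1 prod.inject)
    moreover from this have "parcs F = parcs F'" using *(2) ** by (metis insert_ident)
    ultimately show ?thesis using *(1) by (simp add: pair_pre_digraph.equality)
  qed
  then have "inj_on (\<lambda>(k, F). insert_arc (k, j) F) (?P \<times> ?M)"
    by (auto simp: inj_on_def)
  moreover have "insert_arc (k, j) F \<in> max_spanning_forests G" if k: "k \<in> ?P" and F: "F \<in> ?M" for k F
  proof -
    have "single_valued ((parcs (insert_arc (k, j) F))\<inverse>)"
      using MD(3,4)[OF F] by (auto simp: single_valued_def)
    then show ?thesis
      using k MD[OF F] by (auto simp: max_spanning_forests_iff[OF fin acyc] imm_preds_with_proj)
  qed
  moreover have "F \<in> (\<lambda>(k, F). insert_arc (k, j) F) ` (?P \<times> ?M)" if "F \<in> max_spanning_forests G" for F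
  proof -
    have F: "pverts F = pverts G" "parcs F \<subseteq> parcs G" "single_valued ((parcs F)\<inverse>)"
      "Range (parcs G) \<subseteq> Range (parcs F)"
      using that by (auto simp: max_spanning_forests_iff[OF fin acyc])
    then obtain k where k: "(k, j) \<in> parcs F" using j by blast
    \<comment> \<open>By in-degree at most one, removing all arcs into \<open>j\<close> from
      \<open>F\<close> removes \<open>(k, j)\<close> alone.\<close>
    have "F = insert_arc (k, j) (remove_arcs_into j F)"
      using k by (intro pair_pre_digraph.equality) (auto dest: single_valued_converseD[OF F(3) _ k])
    moreover have "remove_arcs_into j F \<in> ?M"
      unfolding max_spanning_forests_iff[OF fin' acyc']
    proof (intro conjI)
      show "single_valued ((parcs (remove_arcs_into j F))\<inverse>)"
        using F(3) by (rule single_valued_converse_subset) auto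
      show "Range (parcs (remove_arcs_into j G)) \<subseteq> Range (parcs (remove_arcs_into j F))"
        using F(4) by fastforce
    qed (use F in auto)
    moreover have "k \<in> ?P" using k F(2) by (auto simp: imm_preds_with_proj)
    ultimately show ?thesis by (auto intro: image_eqI[where x = "(k, remove_arcs_into j F)"])
  qed
  ultimately show ?thesis by (auto simp: bij_betw_def)
qed

section \<open>The average forest measure in terms of the choice at one node\<close>

lemma AF_eq_sum_over_imm_preds:
  assumes fin: "pair_fin_digraph G" and acyc: "acyclic (parcs G)" and j: "j \<in> Range (parcs G)"
  shows "AF v G x = (\<Sum>k \<in> imm_preds (with_proj G) j.
      \<Sum>F \<in> max_spanning_forests (remove_arcs_into j G). marginal v (insert_arc (k, j) F) x)
    / (real (card (imm_preds (with_proj G) j))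
        * real (card (max_spanning_forests (remove_arcs_into j G))))"
proof -
  note bij = bij_betw_max_spanning_forests[OF assms]
  have "real (card (max_spanning_forests G)) = real (card (imm_preds (with_proj G) j))
      * real (card (max_spanning_forests (remove_arcs_into j G)))"
    using bij_betw_same_card[OF bij] by (simp add: card_cartesian_product flip: of_nat_mult)
  moreover have "(\<Sum>F \<in> max_spanning_forests G. marginal v F x) = (\<Sum>k \<in> imm_preds (with_proj G) j.
      \<Sum>F \<in> max_spanning_forests (remove_arcs_into j G). marginal v (insert_arc (k, j) F) x)"
    using sum.reindex_bij_betw[OF bij, of "\<lambda>F. marginal v F x"]
    by (simp add: sum.cartesian_product case_prod_beta)
  ultimately show ?thesis by (simp add: AF_def)
qed

text \<open>Only the choice \<open>k = x\<close> can alter the marginal contribution of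
  \<open>x\<close>. With \<open>d\<close> choices the sum over \<open>k\<close> is
  \<open>t + (d - 1) * s\<close> if \<open>x\<close> is among them and \<open>d * s\<close>
  otherwise.\<close>

lemma AF_if_not_above_imm_preds:
  fixes v G x j
  defines "M \<equiv> max_spanning_forests (remove_arcs_into j G)"
  defines "s \<equiv> \<Sum>F \<in> M. marginal v F x"
    and "t \<equiv> \<Sum>F \<in> M. marginal v (insert_arc (x, j) F) x"
  assumes fin: "pair_fin_digraph G" and acyc: "acyclic (parcs G)"
    and x: "\<And>k. (k, j) \<in> parcs G \<Longrightarrow> (x, k) \<notin> (parcs G)\<^sup>+"
  shows "AF v G x = (if (x, j) \<in> parcs G
    then (s + (t - s) / real (card (imm_preds (with_proj G) j))) / real (card M)
    else s / real (card M))"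
proof (cases "j \<in> Range (parcs G)")
  case False
  \<comment> \<open>Without arcs into \<open>j\<close> there is no choice to split off, and the
    second case is the definition of \<open>AF\<close>. This arises when the deleted arc was the
    only one into \<open>j\<close>.\<close>
  then have "remove_arcs_into j G = G" by (intro pair_pre_digraph.equality) auto
  with False show ?thesis by (auto simp: AF_def s_def M_def)
next
  case True
  interpret pair_fin_digraph G by fact
  let ?P = "imm_preds (with_proj G) j"
  have P: "finite ?P" "?P \<noteq> {}"
    using True finite_Image[of "(parcs G)\<inverse>" "{j}"] pair_finite_arcs
    by (auto simp: imm_preds_with_proj Image_def)
  have unrelated: "(\<Sum>F \<in> M. marginal v (insert_arc (k, j) F) x) = s" if k: "k \<in> ?P - {x}" for k
    unfolding s_def
  proof (intro sum.cong refl marginal_insert_arc_unrelated)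
    fix F assume "F \<in> M"
    then have "parcs F \<subseteq> parcs G"
      unfolding M_def by (rule max_spanning_forests_remove_arcs_intoD(2)[OF fin acyc])
    \<comment> \<open>Reachability in \<open>F\<close> is reachability in \<open>G\<close>; the
      empty walk is ruled out by \<open>k\<close> being different from \<open>x\<close>.\<close>
    then have "(parcs F)\<^sup>+ \<subseteq> (parcs G)\<^sup>+" by (simp add: trancl_mono_subset)
    with k x show "(x, k) \<notin> (parcs F)\<^sup>*"
      by (auto simp: rtrancl_eq_or_trancl imm_preds_with_proj)
  qed
  have AF: "AF v G x = (\<Sum>k \<in> ?P. \<Sum>F \<in> M. marginal v (insert_arc (k, j) F) x)
      / (real (card ?P) * real (card M))"
    unfolding M_def by (rule AF_eq_sum_over_imm_preds[OF fin acyc True])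
  show ?thesis
  proof (cases "(x, j) \<in> parcs G")
    case True
    then have "x \<in> ?P" by (simp add: imm_preds_with_proj)
    then have "(\<Sum>k \<in> ?P. \<Sum>F \<in> M. marginal v (insert_arc (k, j) F) x) = t + (\<Sum>k \<in> ?P - {x}. s)"
      using P unrelated by (simp add: sum.remove t_def)
    also have "\<dots> = t + (real (card ?P) - 1) * s"
      using P \<open>x \<in> ?P\<close> by (simp add: card_gt_0_iff of_nat_diff Suc_leI)
    finally show ?thesis using True P AF by (simp add: field_simps)
  next
    case False
    then have "?P - {x} = ?P" by (auto simp: imm_preds_with_proj)
    then have "(\<Sum>k \<in> ?P. \<Sum>F \<in> M. marginal v (insert_arc (k, j) F) x) = real (card ?P) * s"
      using unrelated by simp
    then show ?thesis using False P AF by simp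
  qed
qed

section \<open>The effect of deleting an arc\<close>

lemma delete_arc_simps [simp]:
  "pverts (delete_arc G e) = pverts G" "parcs (delete_arc G e) = parcs G - {e}"
  by (simp_all add: delete_arc_def)

text \<open>Here \<open>x\<close> is any immediate predecessor of \<open>j\<close>: a competitor of
  \<open>i\<close> in the first conclusion, the tail of the deleted arc itself in the
  second.\<close>

lemma AF_delete_arc:
  fixes G :: "'a pair_pre_digraph"
  assumes fin: "pair_fin_digraph G" and acyc: "acyclic (parcs G)" and sup: "superadditive (pverts G) v"
    and arc: "(i, j) \<in> parcs G" "(x, j) \<in> parcs G"
    and x: "\<And>k. (k, j) \<in> parcs G \<Longrightarrow> (x, k) \<notin> (parcs G)\<^sup>+"
  shows "x \<noteq> i \<Longrightarrow> AF v G x \<le> AF v (delete_arc G (i, j)) x"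
    and "x = i \<Longrightarrow> AF v (delete_arc G (i, j)) x \<le> AF v G x"
proof -
  interpret pair_fin_digraph G by fact
  let ?G = "delete_arc G (i, j)"
  let ?P = "\<lambda>G. imm_preds (with_proj G) j"
  define M where "M = max_spanning_forests (remove_arcs_into j G)"
  define s where "s = (\<Sum>F \<in> M. marginal v F x)"
  define t where "t = (\<Sum>F \<in> M. marginal v (insert_arc (x, j) F) x)"
  \<comment> \<open>Both digraphs agree away from the arcs into \<open>j\<close>, so they share
    \<open>M\<close>, \<open>s\<close> and \<open>t\<close>.\<close>
  have remove_eq: "remove_arcs_into j ?G = remove_arcs_into j G"
    by (intro pair_pre_digraph.equality) auto
  have fin': "pair_fin_digraph ?G"
    using fin by (rule pair_fin_digraph_fewer_arcs) auto
  have acyc': "acyclic (parcs ?G)"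
    using acyc by (rule acyclic_subset) auto
  have "(parcs ?G)\<^sup>+ \<subseteq> (parcs G)\<^sup>+" by (rule trancl_mono_subset) auto
  with x have x': "(x, k) \<notin> (parcs ?G)\<^sup>+" if "(k, j) \<in> parcs ?G" for k
    using that by auto
  have AF: "AF v G x = (s + (t - s) / real (card (?P G))) / real (card M)"
    using AF_if_not_above_imm_preds[where j = j and v = v, OF fin acyc x] arc(2) unfolding s_def t_def M_def by simp
  \<comment> \<open>After the deletion \<open>x\<close> is still an immediate predecessor of
    \<open>j\<close> exactly when it differs from \<open>i\<close>.\<close>
  have AF': "AF v ?G x = (if x \<noteq> i
      then (s + (t - s) / real (card (?P ?G))) / real (card M) else s / real (card M))"
    using AF_if_not_above_imm_preds[where j = j and v = v, OF fin' acyc' x'] arc(2) unfolding s_def t_def M_def remove_eq by simp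
  have "s \<le> t"
    unfolding s_def t_def
  proof (intro sum_mono marginal_insert_arc_tail)
    fix F assume "F \<in> M"
    then have F: "pverts F = pverts G" "parcs F \<subseteq> parcs G" "single_valued ((parcs F)\<inverse>)"
      "j \<notin> Range (parcs F)"
      unfolding M_def by (rule max_spanning_forests_remove_arcs_intoD[OF fin acyc])+
    show "pair_fin_digraph F" using fin F(1,2) by (rule pair_fin_digraph_fewer_arcs)
    show "acyclic (insert (x, j) (parcs F))"
      using acyc by (rule acyclic_subset) (use F arc in auto)
    show "superadditive (pverts F) v" "x \<in> pverts F" "j \<in> pverts F"
      "single_valued ((parcs F)\<inverse>)" "j \<notin> Range (parcs F)"
      using F sup arc in_arcsD1 in_arcsD2 by auto
  qed
  have "finite (?P G)"
    using finite_Image[of "(parcs G)\<inverse>" "{j}"] pair_finite_arcs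
    by (auto simp: imm_preds_with_proj Image_def)
  show "AF v G x \<le> AF v ?G x" if "x \<noteq> i"
  proof -
    \<comment> \<open>Since \<open>x\<close> survives, the new number of choices is positive and no
      larger, so the bonus \<open>t - s\<close> is shared among no more alternatives.\<close>
    have "?P ?G \<subseteq> ?P G" "x \<in> ?P ?G"
      using that arc by (auto simp: imm_preds_with_proj)
    with \<open>finite (?P G)\<close> have "card (?P ?G) \<le> card (?P G)" "0 < card (?P ?G)"
      by (auto simp: card_gt_0_iff intro: card_mono finite_subset)
    with \<open>s \<le> t\<close> have "(t - s) / real (card (?P G)) \<le> (t - s) / real (card (?P ?G))"
      by (intro divide_left_mono) auto
    then show ?thesis unfolding AF AF' using that by (simp add: divide_right_mono)
  qed
  show "AF v ?G x \<le> AF v G x" if "x = i"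
    unfolding AF AF' using that \<open>s \<le> t\<close> by (simp add: divide_right_mono)
qed

theorem proposition4:
  fixes n :: nat
    and v :: "nat set \<Rightarrow> real"
    and \<Gamma> :: "nat pair_pre_digraph"
    and i\<^sub>0 j\<^sub>0 :: nat
  assumes "n \<ge> 2"
    and "organisational_situation {1..n} v \<Gamma>"
    and "(i\<^sub>0, j\<^sub>0) \<in> parcs \<Gamma>"
  shows "(\<forall>i\<^sub>k \<in> DC \<Gamma> i\<^sub>0 j\<^sub>0.
            (\<forall>j \<in> imm_preds (with_proj \<Gamma>) j\<^sub>0. i\<^sub>k \<notin> preds (with_proj \<Gamma>) j) \<longrightarrow>
            AF v \<Gamma> i\<^sub>k \<le> AF v (delete_arc \<Gamma> (i\<^sub>0, j\<^sub>0)) i\<^sub>k)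
       \<and> (i\<^sub>0 \<notin> IC \<Gamma> i\<^sub>0 j\<^sub>0 \<longrightarrow>
            AF v \<Gamma> i\<^sub>0 \<ge> AF v (delete_arc \<Gamma> (i\<^sub>0, j\<^sub>0)) i\<^sub>0)"
proof -
  have \<Gamma>: "pair_digraph \<Gamma>" "circuit_free (with_proj \<Gamma>)" and sup: "superadditive (pverts \<Gamma>) v"
    using assms(2) by (auto simp: organisational_situation_def)
  interpret pair_digraph \<Gamma> by fact
  have acyc: "acyclic (parcs \<Gamma>)"
    using \<Gamma>(2) circuit_free_iff_acyclic[OF pair_wf_digraph] by simp
  note general = AF_delete_arc[OF pair_fin_digraph acyc sup assms(3)]
  show ?thesis
  proof (intro conjI ballI impI)
    fix i\<^sub>k assume "i\<^sub>k \<in> DC \<Gamma> i\<^sub>0 j\<^sub>0" "\<forall>j \<in> imm_preds (with_proj \<Gamma>) j\<^sub>0. i\<^sub>k \<notin> preds (with_proj \<Gamma>) j"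
    then show "AF v \<Gamma> i\<^sub>k \<le> AF v (delete_arc \<Gamma> (i\<^sub>0, j\<^sub>0)) i\<^sub>k"
      by (intro general(1)) (auto simp: DC_def preds_with_proj imm_preds_with_proj)
  next
    assume IC: "i\<^sub>0 \<notin> IC \<Gamma> i\<^sub>0 j\<^sub>0"
    \<comment> \<open>The case \<open>k = i\<^sub>0\<close> is not covered by \<open>IC\<close>,
      which ranges over competitors only; there acyclicity applies.\<close>
    have "(i\<^sub>0, k) \<notin> (parcs \<Gamma>)\<^sup>+" if "(k, j\<^sub>0) \<in> parcs \<Gamma>" for k
      using that IC acyc
      by (cases "k = i\<^sub>0") (auto simp: IC_def DC_def preds_with_proj imm_preds_with_proj acyclic_def)
    then show "AF v (delete_arc \<Gamma> (i\<^sub>0, j\<^sub>0)) i\<^sub>0 \<le> AF v \<Gamma> i\<^sub>0"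
      using assms(3) by (intro general(2)) auto
  qed
qed

end
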